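(* Let $f\in\mathbb{C}_p[T]$ be a nonzero polynomial and $\zeta\in\mathbb{C}_p$ a root of $f$. Then $\Delta_\zeta(f)=\frac{1}{\gamma(f,\zeta)}$.
   Context: $\mathbb{C}_p$ is the completion of the algebraic closure of $\mathbb{Q}_p$ with absolute value $|\cdot|$. If $f'(\zeta)\neq0$, $\gamma(f,\zeta):=\max_{k\ge2}\left|\frac{f^{(k)}(\zeta)}{k!f'(\zeta)}\right|^{1/(k-1)}$ and otherwise $\gamma(f,\zeta):=\infty$. The local separation of $f$ at its root $\zeta$ is $\Delta_\zeta(f):=\min\{|z-\zeta|: z\in\mathbb{C}_p,\ z\ne\zeta,\ f(z)=0\}$ (understood as $+\infty$ if there is no such $z$) when $\zeta$ is a non-singular root, and $\Delta_\zeta(f):=0$ when $\zeta$ is a singular root. Conventions $1/0=\infty$, $1/\infty=0$. *)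

theory Defs
  imports "HOL-Analysis.Analysis" "HOL-Algebra.Algebraic_Closure_Type"
begin

hide_const (open) Divisibility.prime Polynomials.degree Fraction_Field.Fract

section \<open>Non-Archimedean absolute values and completions\<close>

locale nonarch_abs =
  fixes v :: "'a::field \<Rightarrow> real"
  assumes nonneg: "v x \<ge> 0"
    and eq_0_iff: "v x = 0 \<longleftrightarrow> x = 0"
    and mult: "v (x * y) = v x * v y"
    and ultrametric: "v (x + y) \<le> max (v x) (v y)"
begin

lemma one: "v 1 = 1"
  using mult[of 1 1] eq_0_iff[of 1] by simp

lemma minus: "v (- x) = v x"
proof -
  have "v (-1) * v (-1) = 1" using mult[of "-1" "-1"] one by simp
  hence "v (-1) = 1" using nonneg[of "-1"]
    by (metis abs_of_nonneg abs_mult_self_eq real_sqrt_abs2 real_sqrt_one)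
  thus ?thesis using mult[of "-1" x] by simp
qed

sublocale Metric_space UNIV "\<lambda>x y. v (x - y)"
proof
  fix x y z :: 'a
  show "v (x - y) = v (y - x)" using minus[of "x - y"] by simp
  have "v (x - z) \<le> max (v (x - y)) (v (y - z))"
    using ultrametric[of "x - y" "y - z"] by simp
  thus "v (x - z) \<le> v (x - y) + v (y - z)"
    using nonneg[of "x - y"] nonneg[of "y - z"] by simp
qed (auto simp: nonneg eq_0_iff)

end

text \<open>\<open>(L, w)\<close> together with the embedding \<open>i\<close> is a completion of \<open>(K, v)\<close>.\<close>

locale field_completion = K: nonarch_abs v + L: nonarch_abs w
  for v :: "'k::field \<Rightarrow> real" and w :: "'l::field \<Rightarrow> real" +
  fixes i :: "'k \<Rightarrow> 'l"
  assumes emb_one: "i 1 = 1"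
    and emb_add: "i (x + y) = i x + i y"
    and emb_mult: "i (x * y) = i x * i y"
    and emb_abs: "w (i x) = v x"
    and dense: "L.mtopology closure_of (range i) = UNIV"
    and complete: "L.mcomplete"

section \<open>The $p$-adic absolute value on the rationals\<close>

definition padic_abs :: "nat \<Rightarrow> rat \<Rightarrow> real" where
  "padic_abs p q = (if q = 0 then 0 else
     (case quotient_of q of (a, b) \<Rightarrow>
       real p powi (int (multiplicity (int p) b) - int (multiplicity (int p) a))))"

lemma padic_abs_Fract:
  assumes "prime p" "a \<noteq> 0" "b \<noteq> 0"
  shows "padic_abs p (Fract a b) =
    real p powi (int (multiplicity (int p) b) - int (multiplicity (int p) a))"
proof -
  obtain c d where cd: "quotient_of (Fract a b) = (c, d)" by fastforce
  have d: "d > 0" using cd quotient_of_denom_pos by blast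
  have nz: "Fract a b \<noteq> 0" using assms by (simp add: Zero_rat_def eq_rat)
  have eq: "Fract a b = Fract c d"
    using cd by (metis quotient_of_div Fract_of_int_quotient)
  have c: "c \<noteq> 0" using nz eq by (auto simp: Zero_rat_def eq_rat)
  have pe: "prime_elem (int p)" using assms by simp
  have "a * d = c * b" using eq assms d by (simp add: eq_rat)
  hence "multiplicity (int p) (a * d) = multiplicity (int p) (c * b)" by simp
  hence "multiplicity (int p) a + multiplicity (int p) d
       = multiplicity (int p) c + multiplicity (int p) b"
    using assms c d by (simp add: prime_elem_multiplicity_mult_distrib[OF pe])
  hence "int (multiplicity (int p) d) - int (multiplicity (int p) c)
       = int (multiplicity (int p) b) - int (multiplicity (int p) a)" by linarith
  thus ?thesis using nz cd by (simp add: padic_abs_def)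
qed

lemma nonarch_abs_padic:
  assumes p: "prime p"
  shows "nonarch_abs (padic_abs p)"
proof
  have p0: "real p > 0" and p1: "real p \<ge> 1" using p prime_gt_0_nat prime_ge_1_nat by auto
  have pe: "prime_elem (int p)" using p by simp
  have z: "padic_abs p 0 = 0" by (simp add: padic_abs_def)
  have F: "\<exists>a b. x = Fract a b \<and> a \<noteq> 0 \<and> b \<noteq> 0" if "x \<noteq> 0" for x :: rat
    using that by (cases x) (auto simp: Zero_rat_def eq_rat)
  have pos: "padic_abs p x > 0" if "x \<noteq> 0" for x
    using F[OF that] padic_abs_Fract[OF p] p0 by auto
  show "padic_abs p x \<ge> 0" for x using pos[of x] z by (cases "x = 0") auto
  show "padic_abs p x = 0 \<longleftrightarrow> x = 0" for x using pos[of x] z by (cases "x = 0") auto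
  show "padic_abs p (x * y) = padic_abs p x * padic_abs p y" for x y
  proof (cases "x = 0 \<or> y = 0")
    case False
    then obtain a b c d where *: "x = Fract a b" "a \<noteq> 0" "b \<noteq> 0" "y = Fract c d" "c \<noteq> 0" "d \<noteq> 0"
      using F[of x] F[of y] by auto
    show ?thesis using * p0
      by (simp add: padic_abs_Fract[OF p] prime_elem_multiplicity_mult_distrib[OF pe]
          power_int_add[symmetric] algebra_simps)
  qed (auto simp: z)
  show "padic_abs p (x + y) \<le> max (padic_abs p x) (padic_abs p y)" for x y
  proof (cases "x = 0 \<or> y = 0 \<or> x + y = 0")
    case True
    have "padic_abs p x \<ge> 0" for x using pos[of x] z by (cases "x = 0") auto
    thus ?thesis using True by (auto simp: z le_max_iff_disj)
  next
    case False
    then obtain a b c d where *: "x = Fract a b" "a \<noteq> 0" "b \<noteq> 0" "y = Fract c d" "c \<noteq> 0" "d \<noteq> 0"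
      using F[of x] F[of y] by auto
    let ?m = "multiplicity (int p)"
    have s: "x + y = Fract (a * d + c * b) (b * d)" using * by simp
    have n: "a * d + c * b \<noteq> 0" using False s * by (auto simp: Zero_rat_def eq_rat)
    define k where "k = min (?m (a * d)) (?m (c * b))"
    have "int p ^ k dvd a * d" "int p ^ k dvd c * b"
      by (auto simp: k_def intro: multiplicity_dvd')
    hence "int p ^ k dvd a * d + c * b" by (rule dvd_add)
    hence "k \<le> ?m (a * d + c * b)"
      using n pe multiplicity_geI[of "a * d + c * b" "int p" k] p
      by (metis not_prime_unit prime_nat_int_transfer)
    hence "?m (a * d) \<le> ?m (a * d + c * b) \<or> ?m (c * b) \<le> ?m (a * d + c * b)"
      by (auto simp: k_def min_def split: if_splits)
    thus ?thesis
    proof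
      assume "?m (a * d) \<le> ?m (a * d + c * b)"
      hence "padic_abs p (x + y) \<le> padic_abs p x"
        unfolding s using * n p1
        by (auto simp: padic_abs_Fract[OF p] prime_elem_multiplicity_mult_distrib[OF pe]
            intro!: power_int_increasing)
      thus ?thesis by simp
    next
      assume "?m (c * b) \<le> ?m (a * d + c * b)"
      hence "padic_abs p (x + y) \<le> padic_abs p y"
        unfolding s using * n p1
        by (auto simp: padic_abs_Fract[OF p] prime_elem_multiplicity_mult_distrib[OF pe]
            intro!: power_int_increasing)
      thus ?thesis by simp
    qed
  qed
qed

section \<open>The field $\mathbf{C}_p$\<close>

text \<open>
  The types \<open>'q\<close> and \<open>'c\<close>, with absolute values \<open>absq\<close> and \<open>absc\<close>, are the fields of
  $p$-adic numbers and of complex $p$-adic numbers. These are determined up to isometric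
  isomorphism by being completions of, respectively, the rationals with the $p$-adic absolute
  value and the algebraic closure of \<open>'q\<close> with the absolute value \<open>absa\<close> extending
  \<open>absq\<close>. The embedding of the rationals into \<open>'q\<close> and that of \<open>'q alg_closure\<close> into
  \<open>'c\<close> are parameters as well. The sort constraint on \<open>'c\<close> is no restriction: a field
  containing the rationals has characteristic 0. It is needed for \<open>fact\<close> below.
\<close>

locale padic_complex =
  Qp: field_completion "padic_abs p" absq iq +
  Qpbar: nonarch_abs absa +
  Cp: field_completion absa absc ic
  for p :: nat
    and absq :: "'q::field \<Rightarrow> real" and iq :: "rat \<Rightarrow> 'q"
    and absa :: "'q alg_closure \<Rightarrow> real"
    and absc :: "'c::field_char_0 \<Rightarrow> real" and ic :: "'q alg_closure \<Rightarrow> 'c" +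
  assumes prime: "prime p"
    and absa_extends: "absa (to_ac x) = absq x"

section \<open>The quantity $\gamma$ and the local separation\<close>

text \<open>
  Both are extended nonnegative reals, for which \<open>1 / 0 = \<infinity>\<close> and \<open>1 / \<infinity> = 0\<close>. The supremum and
  the infimum are a maximum and a minimum (see the lemmas below), except that the infimum of the
  empty set is \<open>\<infinity>\<close>, as wanted for a polynomial without a second root.
\<close>

definition gamma :: "('c::field_char_0 \<Rightarrow> real) \<Rightarrow> 'c poly \<Rightarrow> 'c \<Rightarrow> ennreal" where
  "gamma v f \<zeta> =
     (if poly (pderiv f) \<zeta> \<noteq> 0
      then SUP k\<in>{2..}. ennreal
        (v (poly ((pderiv ^^ k) f) \<zeta> / (fact k * poly (pderiv f) \<zeta>)) powr (1 / (real k - 1)))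
      else \<infinity>)"

definition local_separation :: "('c::field_char_0 \<Rightarrow> real) \<Rightarrow> 'c poly \<Rightarrow> 'c \<Rightarrow> ennreal" where
  "local_separation v f \<zeta> =
     (if poly (pderiv f) \<zeta> \<noteq> 0
      then INF z\<in>{z. z \<noteq> \<zeta> \<and> poly f z = 0}. ennreal (v (z - \<zeta>))
      else 0)"

lemma gamma_eq_Max:
  fixes v :: "'c::field_char_0 \<Rightarrow> real"
  assumes "nonarch_abs v" "poly (pderiv f) \<zeta> \<noteq> 0"
  defines "A \<equiv> (\<lambda>k. ennreal (v (poly ((pderiv ^^ k) f) \<zeta> / (fact k * poly (pderiv f) \<zeta>))
                    powr (1 / (real k - 1)))) ` {2..}"
  shows "finite A" "gamma v f \<zeta> = Max A"
proof -
  interpret nonarch_abs v by fact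
  have deg: "degree ((pderiv ^^ k) f) \<le> degree f - k" for k
  proof (induction k)
    case (Suc k)
    show ?case using degree_pderiv[of "(pderiv ^^ k) f"] Suc by simp
  qed simp
  have zero: "(pderiv ^^ k) f = 0" if "k > degree f" for k
  proof -
    from that obtain j where j: "k = Suc j" "j \<ge> degree f" by (cases k) auto
    have "degree ((pderiv ^^ j) f) = 0" using deg[of j] j by simp
    thus ?thesis using j by (auto elim: degree_eq_zeroE simp: pderiv_pCons)
  qed
  have "A \<subseteq> (\<lambda>k. ennreal (v (poly ((pderiv ^^ k) f) \<zeta> / (fact k * poly (pderiv f) \<zeta>))
                    powr (1 / (real k - 1)))) ` {2..degree f} \<union> {0}"
    (is "A \<subseteq> ?g ` _ \<union> _")
  proof
    fix y assume "y \<in> A"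
    then obtain k where k: "k \<ge> 2" "y = ?g k" by (auto simp: A_def)
    show "y \<in> ?g ` {2..degree f} \<union> {0}"
    proof (cases "k \<le> degree f")
      case False
      have "v 0 = 0" using eq_0_iff[of 0] by simp
      thus ?thesis using k zero[of k] False by simp
    qed (use k in auto)
  qed
  thus fin: "finite A" by (rule finite_subset) simp
  have "A \<noteq> {}" by (auto simp: A_def)
  hence "Sup A = Max A" using fin Max_Sup[of A] by simp
  thus "gamma v f \<zeta> = Max A" using assms(2) by (simp add: gamma_def A_def)
qed

lemma local_separation_eq_Min:
  fixes v :: "'c::field_char_0 \<Rightarrow> real"
  assumes "f \<noteq> 0" "poly (pderiv f) \<zeta> \<noteq> 0"
  defines "B \<equiv> (\<lambda>z. ennreal (v (z - \<zeta>))) ` {z. z \<noteq> \<zeta> \<and> poly f z = 0}"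
  shows "finite B" "local_separation v f \<zeta> = (if B = {} then \<infinity> else Min B)"
proof -
  have "finite {z. z \<noteq> \<zeta> \<and> poly f z = 0}"
    by (rule finite_subset[OF _ poly_roots_finite[OF assms(1)]]) auto
  thus fin: "finite B" by (simp add: B_def)
  have "local_separation v f \<zeta> = Inf B" using assms(2) by (simp add: local_separation_def B_def)
  thus "local_separation v f \<zeta> = (if B = {} then \<infinity> else Min B)"
    using fin Min_Inf[of B] by auto
qed

end

theory Submission
  imports Defs
begin

hide_const (open) up_ring.coeff up_ring.monom module.smult Polynomials.lead_coeff

text \<open>
  Translate the root to \<open>0\<close> and write \<open>f(\<zeta> + x) = x h(x)\<close>, so that \<open>\<gamma>\<close> is the largest of the
  numbers \<open>|h\<^sub>k / h\<^sub>0|\<^bsup>1/k\<^esup>\<close>. If \<open>h(x) = 0\<close>, the ultrametric inequality gives some \<open>k \<ge> 1\<close> with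
  \<open>|h\<^sub>0| \<le> |h\<^sub>k| |x|\<^sup>k\<close>, hence \<open>\<gamma> \<ge> 1/|x|\<close>. Conversely, over an algebraically closed field one splits
  off linear factors to see that \<open>|h\<^sub>k| d\<^sup>k \<le> |h\<^sub>0|\<close> as soon as all roots of \<open>h\<close> have absolute value
  at least \<open>d\<close>; hence \<open>\<gamma> \<le> 1/d\<close>.

  The completion of an algebraically closed field is algebraically closed because a monic
  polynomial over the completion is approximated by polynomials over the dense subfield: if \<open>f(a)\<close>
  is small, then so is the product of the distances of \<open>a\<close> from the roots of an approximation, so
  one of these roots is close to \<open>a\<close>. Iterating yields a Cauchy sequence converging to a root.
\<close>

section \<open>Polynomials over a non-Archimedean field\<close>

context nonarch_abs
begin

lemma zero: "v 0 = 0"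
  by (simp add: eq_0_iff)

lemma pos: "x \<noteq> 0 \<Longrightarrow> v x > 0"
  using nonneg[of x] eq_0_iff[of x] by linarith

lemma power: "v (x ^ n) = v x ^ n"
  by (induction n) (simp_all add: one mult)

lemma divide: "v (x / y) = v x / v y"
proof (cases "y = 0")
  case False
  then have "v (x / y) * v y = v x" by (simp flip: mult)
  then show ?thesis using pos[OF False] by (simp add: field_simps)
qed (simp add: zero)

lemma ultrametric_diff: "v (x - y) \<le> max (v x) (v y)"
  using ultrametric[of x "- y"] by (simp add: minus)

lemma sum_le:
  assumes "B \<ge> 0" "\<And>x. x \<in> A \<Longrightarrow> v (g x) \<le> B"
  shows "v (sum g A) \<le> B"
  using assms
proof (induction A rule: infinite_finite_induct)
  case (insert x A)
  then have "max (v (g x)) (v (sum g A)) \<le> B" by simp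
  with ultrametric[of "g x" "sum g A"] have "v (g x + sum g A) \<le> B" by (rule order_trans)
  then show ?case using insert.hyps by simp
qed (simp_all add: zero)

lemma sum_le_some_term:
  assumes "finite A" "A \<noteq> {}"
  obtains x where "x \<in> A" "v (sum g A) \<le> v (g x)"
proof -
  have "Max (v ` g ` A) \<in> v ` g ` A" using assms by simp
  then obtain x where x: "x \<in> A" "v (g x) = Max (v ` g ` A)" by auto
  have "v (sum g A) \<le> v (g x)"
  proof (rule sum_le)
    show "v (g x) \<ge> 0" by (rule nonneg)
  qed (use x assms in auto)
  with x show thesis using that by blast
qed

text \<open>\<open>n\<close> only bounds the degree, so that the estimate applies to a difference of
  polynomials whose leading terms cancel; \<open>R \<ge> 1\<close> makes \<open>R ^ n\<close>
  dominate all lower powers.\<close>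

lemma poly_le:
  assumes "degree f \<le> n" "\<And>k. v (coeff f k) \<le> D" "v x \<le> R" "R \<ge> 1"
  shows "v (poly f x) \<le> D * R ^ n"
proof -
  have D: "D \<ge> 0" using nonneg assms(2) order_trans by blast
  show ?thesis unfolding poly_altdef
  proof (rule sum_le)
    fix k assume "k \<in> {..degree f}"
    with assms(1) have "k \<le> n" by simp
    then have "v x ^ k \<le> R ^ n"
      using assms nonneg power_mono[of "v x" R k] power_increasing[of k n R] by force
    then show "v (coeff f k * x ^ k) \<le> D * R ^ n"
      using assms(2) nonneg D by (simp add: mult power mult_mono)
  qed (use D assms(4) in simp)
qed

text \<open>Outside the ball of radius \<open>R\<close> the leading term strictly outweighs the sum
  of the others. This keeps the roots of all approximating polynomials in one fixed ball.\<close>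

lemma root_le:
  assumes monic: "lead_coeff f = 1" and coeff: "\<And>k. v (coeff f k) \<le> R"
    and R: "R \<ge> 1" and root: "poly f x = 0"
  shows "v x \<le> R"
proof (rule ccontr)
  assume "\<not> v x \<le> R"
  then have x: "v x > R" by simp
  define n where "n = degree f"
  have "n \<noteq> 0"
  proof
    assume "n = 0"
    then obtain c where "f = [:c:]" unfolding n_def by (metis degree_eq_zeroE)
    with monic root show False by simp
  qed
  then obtain m where m: "n = Suc m" by (cases n) auto
  have "poly f x = (\<Sum>k\<le>m. coeff f k * x ^ k) + x ^ n"
    using monic by (simp add: poly_altdef m flip: n_def)
  with root have "x ^ n = - (\<Sum>k\<le>m. coeff f k * x ^ k)"
    by (simp add: eq_neg_iff_add_eq_0 add.commute)
  then have "v x ^ n = v (\<Sum>k\<le>m. coeff f k * x ^ k)" by (metis minus power)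
  also have "\<dots> \<le> R * v x ^ m"
  proof (rule sum_le)
    fix k assume "k \<in> {..m}"
    then have "v x ^ k \<le> v x ^ m" using x R by (intro power_increasing) auto
    then show "v (coeff f k * x ^ k) \<le> R * v x ^ m"
      using coeff nonneg R by (simp add: mult power mult_mono)
  qed (use R nonneg in simp)
  also have "\<dots> < v x * v x ^ m" using x R by (intro mult_strict_right_mono) auto
  finally show False by (simp add: m)
qed

text \<open>If f = (X - z) q, then f_k = q_(k-1) - z q_k, and both terms times \<open>d ^ k\<close>
  are at most |z| |q_0| = |f_0|, the first because d \<le> |z|. Closedness is a hypothesis and not a
  sort, since for the completion it is obtained as a theorem.\<close>

lemma coeff_le_of_roots_ge:
  fixes f :: "'a poly"
  assumes closed: "\<And>g :: 'a poly. degree g > 0 \<Longrightarrow> \<exists>z. poly g z = 0"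
    and "f \<noteq> 0" "d \<ge> 0" "\<And>z. poly f z = 0 \<Longrightarrow> d \<le> v z"
  shows "v (coeff f k) * d ^ k \<le> v (coeff f 0)"
  using assms(2,4)
proof (induction "degree f" arbitrary: f k)
  case 0
  then obtain c where "f = [:c:]" by (metis degree_eq_zeroE)
  then show ?case using nonneg by (cases k) (simp_all add: zero)
next
  case (Suc n)
  then obtain z where z: "poly f z = 0" using closed[of f] by auto
  then obtain q where q: "f = [:- z, 1:] * q" unfolding poly_eq_0_iff_dvd by blast
  have "q \<noteq> 0" using Suc.prems q by auto
  then have "degree f = Suc (degree q)"
    unfolding q by (subst degree_mult_eq) auto
  then have IH: "v (coeff q k) * d ^ k \<le> v (coeff q 0)" for k
    using Suc \<open>q \<noteq> 0\<close> q by simp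
  have dz: "d \<le> v z" using Suc.prems z by blast
  have c0: "v (coeff f 0) = v z * v (coeff q 0)" by (simp add: q mult minus)
  show ?case
  proof (cases k)
    case 0
    then show ?thesis by simp
  next
    case (Suc j)
    have "v (coeff q j) * d ^ k \<le> v z * v (coeff q 0)"
      using mult_mono[OF dz IH[of j]] nonneg \<open>d \<ge> 0\<close> by (simp add: Suc mult_ac)
    moreover have "v (z * coeff q k) * d ^ k \<le> v z * v (coeff q 0)"
      using mult_left_mono[OF IH[of k] nonneg[of z]] by (simp add: mult mult_ac)
    moreover have "v (coeff f k) \<le> max (v (coeff q j)) (v (z * coeff q k))"
      using ultrametric_diff[of "coeff q j" "z * coeff q k"] by (simp add: q Suc)
    then have "v (coeff f k) * d ^ k \<le> max (v (coeff q j)) (v (z * coeff q k)) * d ^ k"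
      using \<open>d \<ge> 0\<close> by (intro mult_right_mono) auto
    ultimately show ?thesis unfolding c0 by (auto simp: max_def split: if_splits)
  qed
qed

text \<open>At a root the constant term is minus the sum of the others, so the largest of these is
  at least as big.\<close>

lemma root_coeff_ge:
  assumes "poly f x = 0" "coeff f 0 \<noteq> 0"
  obtains k where "k \<ge> 1" "v (coeff f 0) \<le> v (coeff f k) * v x ^ k"
proof -
  let ?g = "\<lambda>k. coeff f k * x ^ k"
  have "poly f x = coeff f 0 + (\<Sum>k\<in>{1..degree f}. ?g k)"
    unfolding poly_altdef by (simp add: atMost_atLeast0 sum.atLeast_Suc_atMost)
  with assms have eq: "v (coeff f 0) = v (\<Sum>k\<in>{1..degree f}. ?g k)"
    by (metis minus eq_neg_iff_add_eq_0)
  have "{1..degree f} \<noteq> {}"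
  proof
    assume "{1..degree f} = {}"
    then have "v (coeff f 0) = 0" unfolding eq by (simp only: sum.empty zero)
    with assms show False by (simp add: eq_0_iff)
  qed
  then obtain k where "k \<in> {1..degree f}" "v (sum ?g {1..degree f}) \<le> v (?g k)"
    using sum_le_some_term[of "{1..degree f}" ?g] by auto
  then show thesis using that[of k] eq by (simp add: mult power)
qed

end

text \<open>The value of a monic f at x is the product of x - s over the roots s; were all factors
  at least \<open>\<epsilon>\<close> in size, so would the product be at least
  \<open>\<epsilon> ^ degree f\<close>. The induction splits off one root at a time.\<close>

lemma root_near_small_value:
  fixes f :: "'a::alg_closed_field poly"
  assumes "nonarch_abs v" "lead_coeff f = 1" "\<epsilon> > 0" "v (poly f x) < \<epsilon> ^ degree f"
  shows "\<exists>s. poly f s = 0 \<and> v (x - s) < \<epsilon>"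
  using assms(2,4)
proof (induction "degree f" arbitrary: f)
  case 0
  interpret nonarch_abs v by fact
  from 0 obtain c where "f = [:c:]" by (metis degree_eq_zeroE)
  \<comment> \<open>Here f = 1, so the hypothesis reads 1 < 1.\<close>
  then show ?case using 0 by (simp add: one)
next
  case (Suc n)
  interpret nonarch_abs v by fact
  from Suc obtain z where z: "poly f z = 0" using alg_closed_imp_poly_has_root[of f] by auto
  then obtain q where q: "f = [:- z, 1:] * q" unfolding poly_eq_0_iff_dvd by blast
  have "q \<noteq> 0" using Suc.prems q by auto
  then have deg: "degree f = Suc (degree q)"
    unfolding q by (subst degree_mult_eq) auto
  have monic: "lead_coeff q = 1"
    using Suc.prems(1) unfolding q lead_coeff_mult by simp
  show ?case
  proof (cases "v (x - z) < \<epsilon>")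
    case True
    with z show ?thesis by blast
  next
    case False
    have "\<epsilon> * v (poly q x) \<le> v (x - z) * v (poly q x)"
      using False nonneg by (intro mult_right_mono) auto
    also have "\<dots> < \<epsilon> * \<epsilon> ^ degree q"
      using Suc.prems(2) unfolding deg by (simp add: q flip: mult, simp add: algebra_simps)
    finally have "v (poly q x) < \<epsilon> ^ degree q" using \<open>\<epsilon> > 0\<close> by simp
    then obtain s where "poly q s = 0" "v (x - s) < \<epsilon>"
      using Suc.hyps monic deg by auto
    then show ?thesis by (auto simp: q)
  qed
qed

section \<open>Completions of algebraically closed fields\<close>

context field_completion
begin

lemma emb_zero: "i 0 = 0"
  using emb_add[of 0 0] by (metis add_cancel_right_right)

lemma emb_minus: "i (- x) = - i x"
  using emb_add[of x "- x"] by (simp add: emb_zero add_eq_0_iff)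

lemma emb_diff: "i (x - y) = i x - i y"
  using emb_add[of x "- y"] by (simp add: emb_minus)

lemma emb_power: "i (x ^ n) = i x ^ n"
  by (induction n) (simp_all add: emb_one emb_mult)

lemma emb_sum: "i (sum g A) = (\<Sum>x\<in>A. i (g x))"
  by (induction A rule: infinite_finite_induct) (simp_all add: emb_zero emb_add)

lemma emb_poly: "i (poly f x) = poly (map_poly i f) (i x)"
proof -
  \<comment> \<open>The sums in \<open>poly_altdef\<close> run up to the degrees; injectivity of the
    isometry makes these agree.\<close>
  have "inj i"
  proof
    fix x y assume "i x = i y"
    then have "w (i (x - y)) = 0" by (simp only: emb_diff diff_self L.zero)
    then have "v (x - y) = 0" by (simp only: emb_abs)
    then show "x = y" by (simp add: K.eq_0_iff)
  qed
  then have "degree (map_poly i f) = degree f"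
    using degree_map_poly[of i f] emb_zero by (metis injD)
  then show ?thesis
    by (simp add: poly_altdef emb_sum emb_mult emb_power coeff_map_poly emb_zero)
qed

lemma approximable:
  assumes "\<delta> > 0"
  shows "\<exists>a. w (x - i a) < \<delta>"
proof -
  have "x \<in> L.mtopology closure_of (range i)" by (simp add: dense)
  then show ?thesis using assms unfolding L.metric_closure_of by auto
qed

text \<open>Only the coefficients below the degree are moved. The leading one stays exactly 1, so
  that \<open>root_near_small_value\<close> and \<open>root_le\<close> apply to
  \<open>F\<close>.\<close>

lemma approximate_monic_poly:
  fixes f :: "'l poly"
  assumes "lead_coeff f = 1" "\<delta> > 0"
  obtains F where "degree F = degree f" "lead_coeff F = 1"
    "\<And>k. w (coeff f k - i (coeff F k)) \<le> \<delta>"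
proof -
  have "\<forall>k. \<exists>a. w (coeff f k - i a) < \<delta>" by (simp add: approximable assms(2))
  then obtain c where c: "\<And>k. w (coeff f k - i (c k)) < \<delta>" by metis
  define n where "n = degree f"
  define F where "F = (\<Sum>k<n. monom (c k) k) + monom 1 n"
  have coeff: "coeff F k = (if k < n then c k else if k = n then 1 else 0)" for k
    by (simp add: F_def coeff_sum)
  have deg: "degree F = n"
  proof (rule antisym)
    show "degree F \<le> n" by (rule degree_le) (simp add: coeff)
    show "n \<le> degree F" by (rule le_degree) (simp add: coeff)
  qed
  have "w (coeff f k - i (coeff F k)) \<le> \<delta>" for k
  proof (cases "k < n")
    case True
    with c[of k] show ?thesis by (simp add: coeff)
  next
    case False
    then have "coeff f k = i (coeff F k)"
      using assms(1) by (cases "k = n") (auto simp: coeff n_def emb_one emb_zero coeff_eq_0)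
    then show ?thesis using assms(2) by (simp add: L.zero)
  qed
  then show thesis using that[of F] deg by (simp add: coeff n_def)
qed

text \<open>This is continuity of f along the sequence: f(r_j) - f(l) = (r_j - l) q(r_j) with q the
  quotient of f by X - l, and the values of q stay bounded because the sequence does.\<close>

lemma root_of_small_values:
  assumes "L.MCauchy r" "(\<lambda>j. w (poly f (r j))) \<longlonglongrightarrow> 0"
    and "\<And>j. w (r j) \<le> R" "R \<ge> 1"
  obtains l where "poly f l = 0"
proof -
  obtain l where "limitin L.mtopology r l sequentially"
    using complete assms(1) unfolding L.mcomplete_def by blast
  then have lim: "(\<lambda>j. w (r j - l)) \<longlonglongrightarrow> 0"
    by (simp add: L.limitin_metric_dist_null)
  define q where "q = synthetic_div f l"
  define D where "D = (\<Sum>k\<le>degree q. w (coeff q k)) * R ^ degree q"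
  have "w (coeff q k) \<le> (\<Sum>k\<le>degree q. w (coeff q k))" for k
    by (cases "k \<le> degree q") (auto intro: member_le_sum sum_nonneg simp: L.nonneg coeff_eq_0 L.zero)
  then have D: "w (poly q (r j)) \<le> D" for j
    unfolding D_def by (rule L.poly_le[OF order.refl]) (use assms in auto)
  have "w (poly f l) \<le> w (poly f (r j)) + w (r j - l) * D" for j
  proof -
    have "poly ([:- l, 1:] * q + [:poly f l:]) (r j) = poly f (r j)"
      unfolding q_def by (simp only: synthetic_div_correct')
    then have "poly f l = poly f (r j) - (r j - l) * poly q (r j)"
      by (simp add: algebra_simps)
    then have "w (poly f l) \<le> max (w (poly f (r j))) (w (r j - l) * w (poly q (r j)))"
      using L.ultrametric_diff[of "poly f (r j)" "(r j - l) * poly q (r j)"] by (simp add: L.mult)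
    also have "\<dots> \<le> w (poly f (r j)) + w (r j - l) * w (poly q (r j))"
      using L.nonneg by simp
    also have "\<dots> \<le> w (poly f (r j)) + w (r j - l) * D"
      using D L.nonneg by (simp add: mult_left_mono)
    finally show ?thesis .
  qed
  moreover have "(\<lambda>j. w (poly f (r j)) + w (r j - l) * D) \<longlonglongrightarrow> 0 + 0 * D"
    by (intro tendsto_intros assms lim)
  ultimately have "w (poly f l) \<le> 0 + 0 * D"
    by (intro LIMSEQ_le_const) auto
  then have "poly f l = 0" using L.nonneg[of "poly f l"] L.eq_0_iff by simp
  then show thesis by (rule that)
qed

end

text \<open>If a monic \<open>F\<close> over the subfield is close enough to f, then F(a) is still
  below \<open>\<epsilon> ^ n\<close>, so \<open>F\<close> has a root s within
  \<open>\<epsilon>\<close> of a, and f(s) is close to F(s) = 0.\<close>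

lemma refine_approximate_root:
  fixes v :: "'k::alg_closed_field \<Rightarrow> real" and w :: "'l::field \<Rightarrow> real" and f :: "'l poly"
  assumes "field_completion v w i" and monic: "lead_coeff f = 1"
    and R: "R \<ge> 1" "\<And>k. w (coeff f k) \<le> R"
    and a: "v a \<le> R" "w (poly f (i a)) < \<epsilon> ^ degree f"
    and "\<epsilon> > 0" "\<eta> > 0"
  shows "\<exists>s. v s \<le> R \<and> v (a - s) < \<epsilon> \<and> w (poly f (i s)) < \<eta>"
proof -
  interpret field_completion v w i by fact
  define n where "n = degree f"
  \<comment> \<open>The bound \<open>\<epsilon> ^ n\<close> serves to find a root of
    \<open>F\<close> near a, the bound \<open>\<eta>\<close> to make f small at that root.\<close>
  define e where "e = min (\<epsilon> ^ n) \<eta>"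
  \<comment> \<open>The factor 2 makes the total error \<open>\<delta> * R ^ n\<close> strictly less
    than \<open>e\<close>; the cap 1 keeps the coefficients of \<open>F\<close> within
    \<open>R\<close>.\<close>
  define \<delta> where "\<delta> = min 1 (e / (2 * R ^ n))"
  have "e > 0" and Rn: "R ^ n > 0" using assms by (auto simp: e_def)
  then have \<delta>: "\<delta> > 0" "\<delta> \<le> 1" by (auto simp: \<delta>_def)
  have "\<delta> * R ^ n \<le> e / (2 * R ^ n) * R ^ n"
    using Rn by (intro mult_right_mono) (auto simp: \<delta>_def)
  also have "\<dots> < e" using Rn \<open>e > 0\<close> by (simp add: field_simps)
  finally have \<delta>e: "\<delta> * R ^ n < e" .
  obtain F where F: "degree F = n" "lead_coeff F = 1"
      "\<And>k. w (coeff f k - i (coeff F k)) \<le> \<delta>"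
    using approximate_monic_poly[OF monic \<delta>(1)] unfolding n_def by blast
  have close: "w (poly f (i x) - i (poly F x)) < e" if "v x \<le> R" for x
  proof -
    have "w (poly (f - map_poly i F) (i x)) \<le> \<delta> * R ^ n"
    proof (rule L.poly_le)
      show "degree (f - map_poly i F) \<le> n"
        using F(1) map_poly_degree_leq[of i F] by (intro degree_diff_le) (auto simp: n_def)
      show "w (coeff (f - map_poly i F) k) \<le> \<delta>" for k
        using F(3) by (simp add: coeff_map_poly emb_zero)
    qed (use that R emb_abs in auto)
    with \<delta>e show ?thesis by (simp add: emb_poly)
  qed
  have "v (poly F a) = w (poly f (i a) - (poly f (i a) - i (poly F a)))"
    by (simp add: emb_abs)
  also have "\<dots> \<le> max (w (poly f (i a))) (w (poly f (i a) - i (poly F a)))"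
    by (rule L.ultrametric_diff)
  also have "\<dots> < \<epsilon> ^ degree F"
    using a(2) close[OF a(1)] by (simp add: F(1) n_def e_def)
  finally obtain s where s: "poly F s = 0" "v (a - s) < \<epsilon>"
    using root_near_small_value[OF K.nonarch_abs_axioms F(2) \<open>\<epsilon> > 0\<close>] by blast
  have "v (coeff F k) \<le> R" for k
  proof -
    have "w (i (coeff F k)) \<le> max (w (coeff f k)) (w (coeff f k - i (coeff F k)))"
      using L.ultrametric_diff[of "coeff f k" "coeff f k - i (coeff F k)"] by simp
    also have "\<dots> \<le> R" using R F(3)[of k] \<delta>(2) by simp
    finally show ?thesis by (simp add: emb_abs)
  qed
  then have "v s \<le> R" by (rule K.root_le[OF F(2) _ R(1) s(1)])
  moreover have "w (poly f (i s)) < \<eta>"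
    using close[OF \<open>v s \<le> R\<close>] s(1) by (simp add: emb_zero e_def)
  ultimately show ?thesis using s(2) by blast
qed

text \<open>Refinement is iterated with radii \<open>\<epsilon> j\<close>, each time asking for a
  value below \<open>\<epsilon> (Suc j) ^ n\<close>, which is what the next step takes as its
  hypothesis.\<close>

lemma completion_monic_poly_has_root:
  fixes v :: "'k::alg_closed_field \<Rightarrow> real" and w :: "'l::field \<Rightarrow> real" and f :: "'l poly"
  assumes "field_completion v w i" "lead_coeff f = 1" "degree f > 0"
  shows "\<exists>z. poly f z = 0"
proof -
  interpret field_completion v w i by fact
  define n where "n = degree f"
  define R where "R = Max (insert 1 ((\<lambda>k. w (coeff f k)) ` {..n}))"
  have R1: "R \<ge> 1" by (simp add: R_def)
  have R: "w (coeff f k) \<le> R" for k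
  proof (cases "k \<le> n")
    case True
    then show ?thesis unfolding R_def by (intro Max_ge) auto
  next
    case False
    then show ?thesis using R1 by (simp add: n_def coeff_eq_0 L.zero)
  qed
  define \<epsilon> :: "nat \<Rightarrow> real" where "\<epsilon> j = (1 / 2) ^ j" for j
  have \<epsilon>: "\<epsilon> j > 0" for j by (simp add: \<epsilon>_def)
  let ?P = "\<lambda>j a. v a \<le> R \<and> w (poly f (i a)) < \<epsilon> j ^ n"
  have "\<exists>a. \<forall>j. ?P j (a j) \<and> v (a j - a (Suc j)) < \<epsilon> j"
  proof (rule dependent_nat_choice)
    \<comment> \<open>One refinement of 0 with the crude radius \<open>C\<close> starts the
      sequence: the value at 0 is less than \<open>C\<close>, and C \<le> C^n because C \<ge> 1 and
      n \<ge> 1.\<close>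
    define C where "C = w (poly f (i 0)) + 1"
    have "C \<ge> 1" using L.nonneg by (simp add: C_def)
    then have "w (poly f (i 0)) < C ^ n"
      using power_increasing[of 1 n C] assms(3) by (simp add: C_def n_def)
    then show "\<exists>a. ?P 0 a"
      using refine_approximate_root[OF assms(1,2) R1 R, of 0 C "\<epsilon> 0 ^ n"]
        \<open>C \<ge> 1\<close> R1 \<epsilon>[of 0] by (auto simp: K.zero n_def)
  next
    fix a j assume "?P j a"
    then show "\<exists>s. ?P (Suc j) s \<and> v (a - s) < \<epsilon> j"
      using refine_approximate_root[OF assms(1,2) R1 R, of a "\<epsilon> j" "\<epsilon> (Suc j) ^ n"] \<epsilon>
      by (auto simp: n_def)
  qed
  then obtain a where a: "\<And>j. v (a j) \<le> R" "\<And>j. w (poly f (i (a j))) < \<epsilon> j ^ n"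
      "\<And>j. v (a j - a (Suc j)) < \<epsilon> j" by blast
  \<comment> \<open>By the ultrametric inequality the steps do not add up: the bound
    \<open>\<epsilon> j\<close> on the first one serves for the whole distance.\<close>
  have dist: "v (a j - a (j + m)) \<le> \<epsilon> j" for j m
  proof (induction m)
    case 0
    then show ?case using \<epsilon>[of j] by (simp add: K.zero)
  next
    case (Suc m)
    have "v (a (j + m) - a (Suc (j + m))) \<le> \<epsilon> (j + m)" using a(3) less_imp_le by blast
    also have "\<dots> \<le> \<epsilon> j" unfolding \<epsilon>_def by (rule power_decreasing) auto
    finally show ?case
      using Suc K.ultrametric[of "a j - a (j + m)" "a (j + m) - a (Suc (j + m))"] by simp
  qed
  have lim: "\<epsilon> \<longlonglongrightarrow> 0" unfolding \<epsilon>_def by (rule LIMSEQ_realpow_zero) auto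
  have "L.MCauchy (\<lambda>j. i (a j))"
    unfolding L.MCauchy_def
  proof (intro conjI allI impI)
    fix e :: real assume "e > 0"
    then obtain N where N: "\<epsilon> N < e"
      using order_tendstoD(2)[OF lim] by (auto simp: eventually_sequentially)
    have "w (i (a j) - i (a k)) < e" if "N \<le> j" "N \<le> k" for j k
    proof -
      have "v (a N - a j) \<le> \<epsilon> N" "v (a N - a k) \<le> \<epsilon> N"
        using dist[of N "j - N"] dist[of N "k - N"] that by auto
      then have "v (a j - a k) \<le> \<epsilon> N"
        using K.ultrametric_diff[of "a N - a k" "a N - a j"] by simp
      with N show ?thesis by (metis emb_abs emb_diff le_less_trans)
    qed
    then show "\<exists>N. \<forall>j k. N \<le> j \<longrightarrow> N \<le> k \<longrightarrow> w (i (a j) - i (a k)) < e" by blast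
  qed simp
  moreover have "(\<lambda>j. w (poly f (i (a j)))) \<longlonglongrightarrow> 0"
  proof (rule tendsto_sandwich[OF _ _ tendsto_const])
    \<comment> \<open>The limit is 0^n, which is 0 because n > 0.\<close>
    show "(\<lambda>j. \<epsilon> j ^ n) \<longlonglongrightarrow> 0"
      using tendsto_power[OF lim, of n] assms(3) by (simp add: n_def power_0_left)
    show "\<forall>\<^sub>F j in sequentially. 0 \<le> w (poly f (i (a j)))"
      by (simp add: L.nonneg)
    show "\<forall>\<^sub>F j in sequentially. w (poly f (i (a j))) \<le> \<epsilon> j ^ n"
      using a(2) less_imp_le by (intro always_eventually) blast
  qed
  ultimately obtain l where "poly f l = 0"
    by (rule root_of_small_values[of _ _ R]) (use a(1) R1 in \<open>auto simp: emb_abs\<close>)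
  then show ?thesis by blast
qed

lemma completion_poly_has_root:
  fixes v :: "'k::alg_closed_field \<Rightarrow> real" and w :: "'l::field \<Rightarrow> real" and f :: "'l poly"
  assumes "field_completion v w i" "degree f > 0"
  shows "\<exists>z. poly f z = 0"
proof -
  let ?c = "inverse (lead_coeff f)"
  have "?c \<noteq> 0" using assms(2) by auto
  then have "\<exists>z. poly (smult ?c f) z = 0"
    using assms(2) by (intro completion_monic_poly_has_root[OF assms(1)]) auto
  then show ?thesis using \<open>?c \<noteq> 0\<close> by auto
qed

section \<open>The local separation\<close>

text \<open>These are the Taylor coefficients: differentiation commutes with translation, and the
  k-th derivative of the translate at 0 is k! times its k-th coefficient.\<close>

lemma coeff_pcompose_translation:
  fixes f :: "'a::field_char_0 poly"
  shows "coeff (f \<circ>\<^sub>p [:\<zeta>, 1:]) k = poly ((pderiv ^^ k) f) \<zeta> / fact k"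
proof -
  have "(pderiv ^^ k) (f \<circ>\<^sub>p [:\<zeta>, 1:]) = (pderiv ^^ k) f \<circ>\<^sub>p [:\<zeta>, 1:]"
    by (induction k) (simp_all add: pderiv_pcompose pderiv_pCons)
  then have "poly ((pderiv ^^ k) f) \<zeta> = coeff ((pderiv ^^ k) (f \<circ>\<^sub>p [:\<zeta>, 1:])) 0"
    by (simp add: poly_pcompose flip: poly_0_coeff_0)
  also have "\<dots> = fact k * coeff (f \<circ>\<^sub>p [:\<zeta>, 1:]) k"
    by (simp add: coeff_higher_pderiv pochhammer_fact)
  finally show ?thesis by simp
qed

lemma one_divide_ennreal: "d > 0 \<Longrightarrow> 1 / ennreal d = ennreal (1 / d)"
  using divide_ennreal[of 1 d] by simp

text \<open>The values 0 and \<infinity> are included, so bounds on \<gamma> can be inverted even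
  when \<gamma> is 0, as for linear f.\<close>

lemma one_divide_antimono_ennreal: "(x::ennreal) \<le> y \<Longrightarrow> 1 / y \<le> 1 / x"
  by (simp add: divide_ennreal_def less_eq_ennreal.rep_eq inverse_ennreal.rep_eq ereal_inverse_antimono)

lemma local_separation_eq_inverse_gamma:
  fixes v :: "'a::field_char_0 \<Rightarrow> real"
  assumes "nonarch_abs v" and closed: "\<And>g :: 'a poly. degree g > 0 \<Longrightarrow> \<exists>z. poly g z = 0"
    and root: "poly f \<zeta> = 0"
  shows "local_separation v f \<zeta> = 1 / gamma v f \<zeta>"
proof (cases "poly (pderiv f) \<zeta> = 0")
  \<comment> \<open>At a singular root the separation is 0 and \<gamma> is \<infinity> by
    definition, and 1 / \<infinity> = 0.\<close>
  case True
  then show ?thesis by (simp add: local_separation_def gamma_def)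
next
  case nonsing: False
  interpret nonarch_abs v by fact
  \<comment> \<open>The constant term \<open>c\<close> is f(\<zeta>) = 0, so \<open>h\<close> is
    f(\<zeta> + x) / x.\<close>
  obtain c h where "f \<circ>\<^sub>p [:\<zeta>, 1:] = pCons c h" by (metis pCons_cases)
  moreover from this have "c = 0"
    using coeff_pcompose_translation[of f \<zeta> 0] root by simp
  ultimately have h: "f \<circ>\<^sub>p [:\<zeta>, 1:] = pCons 0 h" by simp
  have coeff_h: "coeff h k = poly ((pderiv ^^ Suc k) f) \<zeta> / fact (Suc k)" for k
    using coeff_pcompose_translation[of f \<zeta> "Suc k"] by (simp add: h)
  have h0: "coeff h 0 = poly (pderiv f) \<zeta>" using coeff_h[of 0] by simp
  have "poly f (x + \<zeta>) = x * poly h x" for x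
    using arg_cong[OF h, of "\<lambda>p. poly p x"] by (simp add: poly_pcompose add.commute)
  \<comment> \<open>Since h(0) = f'(\<zeta>) is nonzero, the roots of \<open>h\<close> are exactly
    the differences z - \<zeta> for the other roots z of f.\<close>
  then have roots: "poly h x = 0 \<longleftrightarrow> x \<noteq> 0 \<and> poly f (x + \<zeta>) = 0" for x
    using h0 nonsing by (cases "x = 0") (auto simp: poly_0_coeff_0)
  \<comment> \<open>The j-th root of \<open>t j\<close> is the term of index j + 1 in
    \<open>gamma\<close>: division by x shifts the indices and turns the exponent 1/(k - 1) into
    1/j.\<close>
  define t where "t j = v (coeff h j) / v (coeff h 0)" for j
  have t_nonneg: "t j \<ge> 0" for j by (simp add: t_def nonneg)
  have v0: "v (coeff h 0) > 0" using pos h0 nonsing by simp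
  have t: "v (poly ((pderiv ^^ k) f) \<zeta> / (fact k * poly (pderiv f) \<zeta>)) = t (k - 1)"
    if "k \<in> {2..}" for k
  proof -
    from that have "Suc (k - 1) = k" by simp
    with coeff_h[of "k - 1"] show ?thesis by (simp only: t_def h0 divide mult divide_divide_eq_left)
  qed
  have "gamma v f \<zeta> = (SUP k\<in>{2..}. ennreal (t (k - 1) powr (1 / (real k - 1))))"
    unfolding gamma_def if_P[OF nonsing] using t by (intro SUP_cong) auto
  also have "\<dots> = (SUP j\<in>{1..}. ennreal (t j powr (1 / real j)))"
  proof -
    have "{2..} = Suc ` {1..}"
    proof
      show "{2..} \<subseteq> Suc ` {1..}"
      proof
        fix k :: nat assume "k \<in> {2..}"
        then show "k \<in> Suc ` {1..}" by (cases k) auto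
      qed
    qed auto
    then show ?thesis by (simp only:) (simp add: image_image)
  qed
  finally have gamma: "gamma v f \<zeta> = \<dots>" .
  have powr_power: "(y ^ j) powr (1 / real j) = y" if "y > 0" "j \<ge> 1" for y :: real and j
    using that by (simp add: powr_powr flip: powr_realpow)
  show ?thesis
  proof (rule antisym)
    show "local_separation v f \<zeta> \<le> 1 / gamma v f \<zeta>"
    \<comment> \<open>Any x below the separation is a finite real \<open>d\<close>, even if the
      separation is \<infinity>, and \<open>d\<close> bounds the roots of \<open>h\<close> from
      below.\<close>
    proof (rule dense_le)
      fix x assume x: "x < local_separation v f \<zeta>"
      then obtain d where d: "x = ennreal d" "d \<ge> 0" by (cases x) auto
      show "x \<le> 1 / gamma v f \<zeta>"
      proof (cases "d = 0")
        case False
        then have "d > 0" using d by simp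
        have "d \<le> v z" if "poly h z = 0" for z
        proof -
          have "local_separation v f \<zeta> \<le> ennreal (v z)"
            unfolding local_separation_def using nonsing that
            by (auto intro!: INF_lower2[of "z + \<zeta>"] simp: roots)
          with x d have "ennreal d \<le> ennreal (v z)" by simp
          then show ?thesis using nonneg by simp
        qed
        then have "v (coeff h j) * d ^ j \<le> v (coeff h 0)" for j
          using h0 nonsing d by (intro coeff_le_of_roots_ge closed) auto
        then have t_le: "t j \<le> (1 / d) ^ j" for j
          using \<open>d > 0\<close> v0 by (simp add: t_def field_simps)
        have "t j powr (1 / real j) \<le> 1 / d" if "j \<ge> 1" for j
          using powr_mono2[OF _ t_nonneg t_le, of "1 / real j" j] powr_power[of "1 / d" j]
            \<open>d > 0\<close> that by simp
        then have "gamma v f \<zeta> \<le> ennreal (1 / d)"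
          unfolding gamma by (intro SUP_least ennreal_leI) auto
        from one_divide_antimono_ennreal[OF this] show ?thesis
          using \<open>d > 0\<close> by (simp add: one_divide_ennreal d)
      qed (simp add: d)
    qed
    show "1 / gamma v f \<zeta> \<le> local_separation v f \<zeta>"
      unfolding local_separation_def using nonsing
    proof (simp, intro INF_greatest)
      fix z assume "z \<in> {z. z \<noteq> \<zeta> \<and> poly f z = 0}"
      then have "poly h (z - \<zeta>) = 0" and z: "v (z - \<zeta>) > 0" by (auto simp: roots pos)
      \<comment> \<open>The dominant term gives 1 \<le> t_j |z - \<zeta>|^j; taking j-th roots
        bounds 1/|z - \<zeta>| by one member of the supremum.\<close>
      then obtain j where j: "j \<ge> 1" "v (coeff h 0) \<le> v (coeff h j) * v (z - \<zeta>) ^ j"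
        using root_coeff_ge h0 nonsing by metis
      then have "(1 / v (z - \<zeta>)) ^ j \<le> t j"
        using v0 z by (simp add: t_def field_simps)
      from powr_mono2[OF _ _ this, of "1 / real j"]
      have "1 / v (z - \<zeta>) \<le> t j powr (1 / real j)"
        using powr_power[of "1 / v (z - \<zeta>)" j] z j(1) by simp
      then have "ennreal (1 / v (z - \<zeta>)) \<le> gamma v f \<zeta>"
        unfolding gamma using j(1) by (intro SUP_upper2[of j] ennreal_leI) auto
      from one_divide_antimono_ennreal[OF this] show "1 / gamma v f \<zeta> \<le> ennreal (v (z - \<zeta>))"
        using z by (simp add: one_divide_ennreal)
    qed
  qed
qed

theorem theorem3p15:
  fixes p :: nat
    and absq :: "'q::field \<Rightarrow> real" and iq :: "rat \<Rightarrow> 'q"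
    and absa :: "'q alg_closure \<Rightarrow> real"
    and absc :: "'c::field_char_0 \<Rightarrow> real" and ic :: "'q alg_closure \<Rightarrow> 'c"
    and f :: "'c poly" and \<zeta> :: 'c
  assumes "padic_complex p absq iq absa absc ic"
    and "f \<noteq> 0"
    and "poly f \<zeta> = 0"
  shows "local_separation absc f \<zeta> = 1 / gamma absc f \<zeta>"
proof -
  interpret padic_complex p absq iq absa absc ic by fact
  show ?thesis
    by (rule local_separation_eq_inverse_gamma[OF Cp.L.nonarch_abs_axioms
          completion_poly_has_root[OF Cp.field_completion_axioms] assms(3)])
qed

end
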